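(* Let $l\ge2$ be fixed, and for $k\ge l$ let $g(x_1,\dots,x_k)=\sum_{1\le i_1<\cdots<i_l\le k}x_{i_1}\cdots x_{i_l}$ be the elementary symmetric polynomial of degree $l$ in $k$ variables. Suppose the underlying variables are i.i.d. $N(0,1)$. Then the relative incremental index is given by \[ I_k(g)=\frac{l(l-1)(l+1)}{k(k-1)(2k-l+1)} . \] In particular, $I_k(g)$ is strictly decreasing in $k$.
   Context: Let $\nu=N(0,1)$, $\pi_k=\nu^{\otimes k}$, let $\mathcal H_k$ be the mean-zero functions in $L^2(\mathbb R^k,\pi_k)$ with norm $\|\cdot\|$, let $X_1,X_2,\dots$ be i.i.d. with law $\nu$, and $Y_i=(X_i,\dots,X_{i+k-1})$. For $f\in\mathcal H_k$ the asymptotic variance is $\sigma^2(f)=\operatorname{Var}(f(Y_1))+2\sum_{r=1}^{k-1}\operatorname{Cov}(f(Y_1),f(Y_{1+r}))$. Let $P$ be given by $Pf(x_1,\dots,x_k)=\int f(x_2,\dots,x_k,\xi)\,\nu(d\xi)$, $B_k=I+P+P^*+\cdots+P^{k-1}+(P^* )^{k-1}$, and let $\mathcal L_1$ be the eigenspace of $B_k$ in $\mathcal H_k$ for eigenvalue $1$; equivalently, the set of $f\in\mathcal H_k$ with $\int f\,\nu(dx_1)=0$ and $\int f\,\nu(dx_k)=0$. The incremental component $f^{\mathrm{inc}}$ is the orthogonal projection of $f$ onto $\mathcal L_1$, and the relative incremental index is $I_k(f)=\|f^{\mathrm{inc}}\|^2/\sigma^2(f)$. *)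

theory Defs
  imports "HOL-Probability.Probability"
begin

definition std_normal :: "real measure"  (\<open>\<nu>\<close>)
  where "\<nu> = density lborel (\<lambda>x. ennreal (std_normal_density x))"

text \<open>
  A point of $R^k$ is an extensional function on the index set \<open>{1..k}\<close>, so that \<open>x i\<close> is the
  coordinate $x_i$.
\<close>
definition gauss :: "nat \<Rightarrow> (nat \<Rightarrow> real) measure"  (\<open>\<pi>\<close>)
  where "\<pi> k = PiM {1..k} (\<lambda>_. \<nu>)"

text \<open>
  Elements of $L^2$ are represented by functions rather than by equivalence classes; equality
  in $L^2$ is almost-everywhere equality, and subspaces are closed under it.
\<close>
definition mean_zero_L2 :: "nat \<Rightarrow> ((nat \<Rightarrow> real) \<Rightarrow> real) set"  (\<open>\<H>\<close>)
  where "\<H> k = {f \<in> borel_measurable (\<pi> k).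
           integrable (\<pi> k) (\<lambda>x. (f x)\<^sup>2) \<and> integral\<^sup>L (\<pi> k) f = 0}"

definition inner_prod :: "nat \<Rightarrow> ((nat \<Rightarrow> real) \<Rightarrow> real) \<Rightarrow> ((nat \<Rightarrow> real) \<Rightarrow> real) \<Rightarrow> real"
  where "inner_prod k f g = (LINT x|\<pi> k. f x * g x)"

definition L2_nrm :: "nat \<Rightarrow> ((nat \<Rightarrow> real) \<Rightarrow> real) \<Rightarrow> real"
  where "L2_nrm k f = sqrt (inner_prod k f f)"

definition P :: "nat \<Rightarrow> ((nat \<Rightarrow> real) \<Rightarrow> real) \<Rightarrow> (nat \<Rightarrow> real) \<Rightarrow> real"
  where "P k f = (\<lambda>x. LINT \<xi>|\<nu>. f (\<lambda>i\<in>{1..k}. if i < k then x (i + 1) else \<xi>))"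

text \<open>
  The Hilbert space adjoint of \<open>P k\<close> on \<open>\<H> k\<close>. It is determined up to almost-everywhere
  equality only; \<open>SOME\<close> picks a representative.
\<close>
definition P_adj :: "nat \<Rightarrow> ((nat \<Rightarrow> real) \<Rightarrow> real) \<Rightarrow> (nat \<Rightarrow> real) \<Rightarrow> real"
  where "P_adj k f =
    (SOME h. h \<in> \<H> k \<and> (\<forall>g\<in>\<H> k. inner_prod k (P k g) f = inner_prod k g h))"

definition B :: "nat \<Rightarrow> ((nat \<Rightarrow> real) \<Rightarrow> real) \<Rightarrow> (nat \<Rightarrow> real) \<Rightarrow> real"
  where "B k f = (\<lambda>x. f x + (\<Sum>r=1..k-1. (P k ^^ r) f x + (P_adj k ^^ r) f x))"

definition eigenspace_one :: "nat \<Rightarrow> ((nat \<Rightarrow> real) \<Rightarrow> real) set"  (\<open>\<L>\<^sub>1\<close>)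
  where "\<L>\<^sub>1 k = {f \<in> \<H> k. AE x in \<pi> k. B k f x = f x}"

text \<open>The orthogonal projection of \<open>f\<close> onto \<open>\<L>\<^sub>1 k\<close>, again a representative chosen by \<open>SOME\<close>.\<close>
definition f_inc :: "nat \<Rightarrow> ((nat \<Rightarrow> real) \<Rightarrow> real) \<Rightarrow> (nat \<Rightarrow> real) \<Rightarrow> real"
  where "f_inc k f =
    (SOME p. p \<in> \<L>\<^sub>1 k \<and> (\<forall>h\<in>\<L>\<^sub>1 k. inner_prod k (\<lambda>x. f x - p x) h = 0))"

definition iid_std_normal :: "'w measure \<Rightarrow> (nat \<Rightarrow> 'w \<Rightarrow> real) \<Rightarrow> bool"
  where "iid_std_normal M X \<longleftrightarrow>
    prob_space M \<and> prob_space.indep_vars M (\<lambda>_. borel) X {1..} \<and>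
    (\<forall>i\<ge>1. distr M borel (X i) = \<nu>)"

definition Y :: "(nat \<Rightarrow> 'w \<Rightarrow> real) \<Rightarrow> nat \<Rightarrow> nat \<Rightarrow> 'w \<Rightarrow> nat \<Rightarrow> real"
  where "Y X k i \<omega> = (\<lambda>j\<in>{1..k}. X (i + j - 1) \<omega>)"

definition Cov :: "'w measure \<Rightarrow> ('w \<Rightarrow> real) \<Rightarrow> ('w \<Rightarrow> real) \<Rightarrow> real"
  where "Cov M U V = (LINT \<omega>|M. (U \<omega> - integral\<^sup>L M U) * (V \<omega> - integral\<^sup>L M V))"

definition asymp_var ::
    "'w measure \<Rightarrow> (nat \<Rightarrow> 'w \<Rightarrow> real) \<Rightarrow> nat \<Rightarrow> ((nat \<Rightarrow> real) \<Rightarrow> real) \<Rightarrow> real"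
  where "asymp_var M X k f =
    prob_space.variance M (\<lambda>\<omega>. f (Y X k 1 \<omega>)) +
    2 * (\<Sum>r=1..k-1. Cov M (\<lambda>\<omega>. f (Y X k 1 \<omega>)) (\<lambda>\<omega>. f (Y X k (1 + r) \<omega>)))"

definition rel_inc_index ::
    "'w measure \<Rightarrow> (nat \<Rightarrow> 'w \<Rightarrow> real) \<Rightarrow> nat \<Rightarrow> ((nat \<Rightarrow> real) \<Rightarrow> real) \<Rightarrow> real"
  where "rel_inc_index M X k f = (L2_nrm k (f_inc k f))\<^sup>2 / asymp_var M X k f"

text \<open>Index tuples $i_1 < \dots < i_l$ in \<open>{1..k}\<close> are encoded as the \<open>l\<close>-element subsets of \<open>{1..k}\<close>.\<close>
definition elem_sym :: "nat \<Rightarrow> nat \<Rightarrow> (nat \<Rightarrow> real) \<Rightarrow> real"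
  where "elem_sym l k x = (\<Sum>I | I \<subseteq> {1..k} \<and> card I = l. \<Prod>i\<in>I. x i)"

end

theory Submission
  imports Defs
begin

text \<open>
  The square-free monomials are orthonormal in \<open>L\<^sup>2\<close>, and both \<open>P\<close> and its adjoint translate them,
  sending to \<open>0\<close> those that leave the window \<open>{1..k}\<close>. Hence for \<open>h \<in> \<L>\<^sub>1\<close> the equation
  \<open>B k h = h\<close> is a linear system for the coefficients of \<open>h\<close> along the translates of one monomial,
  and it forces them to vanish unless the monomial admits no translate, that is, contains both
  \<open>x\<^sub>1\<close> and \<open>x\<^sub>k\<close>. So the incremental component of the elementary symmetric polynomial consists of
  its \<open>(k - 2) choose (l - 2)\<close> monomials of that kind. Counting the monomials common to two
  windows at distance \<open>r\<close> gives the covariances \<open>(k - r) choose l\<close>, and summing them gives the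
  asymptotic variance \<open>(k choose l) + 2 * (k choose (l + 1))\<close>.
\<close>

section \<open>Square-integrable functions and partial integration\<close>

lemma integrable_mult_of_squares:
  fixes f g :: "'a \<Rightarrow> real"
  assumes [measurable]: "f \<in> borel_measurable M" "g \<in> borel_measurable M"
    and "integrable M (\<lambda>x. (f x)\<^sup>2)" "integrable M (\<lambda>x. (g x)\<^sup>2)"
  shows "integrable M (\<lambda>x. f x * g x)"
proof (rule Bochner_Integration.integrable_bound)
  show "integrable M (\<lambda>x. (f x)\<^sup>2 + (g x)\<^sup>2)"
    using assms by simp
  have "\<bar>a * b\<bar> \<le> a\<^sup>2 + b\<^sup>2" for a b :: real
    using sum_squares_bound[of "\<bar>a\<bar>" "\<bar>b\<bar>"] abs_ge_zero[of "a * b"]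
    unfolding abs_mult power2_abs by linarith
  then show "AE x in M. norm (f x * g x) \<le> norm ((f x)\<^sup>2 + (g x)\<^sup>2)"
    by simp
qed simp

lemma (in prob_space) expectation_power2_le:
  fixes f :: "'a \<Rightarrow> real"
  assumes "f \<in> borel_measurable M" "integrable M (\<lambda>x. (f x)\<^sup>2)"
  shows "(expectation f)\<^sup>2 \<le> expectation (\<lambda>x. (f x)\<^sup>2)"
  using variance_eq[of f] variance_positive[of f] square_integrable_imp_integrable[OF assms] assms
  by simp

text \<open>Jensen's inequality on almost every section of \<open>F\<close> bounds the integrand by
  the partial integral of the square, which is integrable by Fubini.\<close>

lemma (in pair_prob_space) partial_integral_square:
  fixes F :: "'a \<times> 'b \<Rightarrow> real"
  assumes F[measurable]: "F \<in> borel_measurable (M1 \<Otimes>\<^sub>M M2)"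
    and F2: "integrable (M1 \<Otimes>\<^sub>M M2) (\<lambda>z. (F z)\<^sup>2)"
  shows "integrable M1 (\<lambda>x. (\<integral>y. F (x, y) \<partial>M2)\<^sup>2)"
proof (rule Bochner_Integration.integrable_bound)
  show "integrable M1 (\<lambda>x. \<integral>y. (F (x, y))\<^sup>2 \<partial>M2)"
    using integrable_fst'[OF F2] .
  have "AE x in M1. (\<integral>y. F (x, y) \<partial>M2)\<^sup>2 \<le> (\<integral>y. (F (x, y))\<^sup>2 \<partial>M2)"
    using AE_integrable_fst'[OF F2] AE_space
    by eventually_elim (rule M2.expectation_power2_le, simp_all)
  then show "AE x in M1. norm ((\<integral>y. F (x, y) \<partial>M2)\<^sup>2) \<le> norm (\<integral>y. (F (x, y))\<^sup>2 \<partial>M2)"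
    by eventually_elim (simp add: order.trans[OF _ abs_ge_self])
qed simp

lemma (in pair_prob_space) integral_mult_partial_integral:
  fixes F :: "'a \<times> 'b \<Rightarrow> real" and u :: "'a \<Rightarrow> real"
  assumes F[measurable]: "F \<in> borel_measurable (M1 \<Otimes>\<^sub>M M2)"
    and F2: "integrable (M1 \<Otimes>\<^sub>M M2) (\<lambda>z. (F z)\<^sup>2)"
    and u[measurable]: "u \<in> borel_measurable M1"
    and u2: "integrable M1 (\<lambda>x. (u x)\<^sup>2)"
  shows "(\<integral>x. u x * (\<integral>y. F (x, y) \<partial>M2) \<partial>M1) = (\<integral>z. u (fst z) * F z \<partial>(M1 \<Otimes>\<^sub>M M2))"
proof -
  have "integrable (distr (M1 \<Otimes>\<^sub>M M2) M1 fst) (\<lambda>x. (u x)\<^sup>2)"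
    using u2 by (simp add: M2.distr_pair_fst)
  then have "integrable (M1 \<Otimes>\<^sub>M M2) (\<lambda>z. (u (fst z))\<^sup>2)"
    by (subst (asm) integrable_distr_eq) auto
  with F2 have "integrable (M1 \<Otimes>\<^sub>M M2) (\<lambda>z. u (fst z) * F z)"
    by (intro integrable_mult_of_squares) auto
  from integral_fst'[OF this] show ?thesis by simp
qed

section \<open>The shift operator and its adjoint\<close>

lemma sets_std_normal[simp, measurable_cong]: "sets \<nu> = sets borel"
  and space_std_normal[simp]: "space \<nu> = UNIV"
  by (simp_all add: std_normal_def)

lemma prob_space_std_normal: "prob_space \<nu>"
  unfolding std_normal_def by (rule prob_space_normal_density) simp

lemma std_normal_mean: "integrable \<nu> (\<lambda>x. x)" "integral\<^sup>L \<nu> (\<lambda>x. x) = 0"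
  using std_normal_moment_odd[of 0]
  by (auto simp: std_normal_def integrable_density integral_density has_bochner_integral_iff)

lemma std_normal_second_moment: "integrable \<nu> (\<lambda>x. x\<^sup>2)" "integral\<^sup>L \<nu> (\<lambda>x. x\<^sup>2) = 1"
  using std_normal_moment_even[of 1]
  by (auto simp: std_normal_def integrable_density integral_density has_bochner_integral_iff)

interpretation std_normal: prob_space \<nu>
  by (rule prob_space_std_normal)

interpretation std_normal_prod: product_sigma_finite "\<lambda>_::nat. \<nu>"
  by unfold_locales

interpretation gauss: prob_space "\<pi> k" for k
  unfolding gauss_def by (intro prob_space_PiM prob_space_std_normal)

interpretation gauss_pair: pair_prob_space "\<pi> k" \<nu> for k
  by unfold_locales

lemma measurable_gauss_component[measurable]: "i \<in> {1..k} \<Longrightarrow> (\<lambda>x. x i) \<in> borel_measurable (\<pi> k)"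
  unfolding gauss_def by measurable

lemma measurable_into_gauss:
  assumes "\<And>i. i \<in> {1..k} \<Longrightarrow> (\<lambda>x. f x i) \<in> borel_measurable M"
    and "\<And>x. f x \<in> extensional {1..k}"
  shows "f \<in> measurable M (\<pi> k)"
proof -
  have "(\<lambda>x. \<lambda>i\<in>{1..k}. f x i) \<in> measurable M (PiM {1..k} (\<lambda>_. \<nu>))"
    using assms(1) by (intro measurable_restrict) (simp cong: measurable_cong_sets)
  then show ?thesis
    by (simp only: gauss_def extensional_restrict[OF assms(2)])
qed

text \<open>A pair is read as \<open>k + 1\<close> independent normal variables, of which a window
  keeps \<open>k\<close>. This one is the argument of \<open>f\<close> inside \<open>P k f\<close>,
  named so that its law can be studied; \<open>window_left\<close> is its mirror image.\<close>

definition window_right :: "nat \<Rightarrow> (nat \<Rightarrow> real) \<times> real \<Rightarrow> nat \<Rightarrow> real"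
  where "window_right k z = (\<lambda>i\<in>{1..k}. if i < k then fst z (i + 1) else snd z)"

definition window_left :: "nat \<Rightarrow> (nat \<Rightarrow> real) \<times> real \<Rightarrow> nat \<Rightarrow> real"
  where "window_left k z = (\<lambda>i\<in>{1..k}. if i = 1 then snd z else fst z (i - 1))"

text \<open>Unlike a window, the rotation loses nothing: the coordinate that leaves becomes the new
  spare one. A change of variables along it exchanges left and right windows.\<close>

definition rotate_window :: "nat \<Rightarrow> (nat \<Rightarrow> real) \<times> real \<Rightarrow> (nat \<Rightarrow> real) \<times> real"
  where "rotate_window k z = (window_right k z, fst z 1)"

lemma window_right_measurable[measurable]: "window_right k \<in> measurable (\<pi> k \<Otimes>\<^sub>M \<nu>) (\<pi> k)"
proof (rule measurable_into_gauss)
  fix i assume i: "i \<in> {1..k}"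
  show "(\<lambda>z. window_right k z i) \<in> borel_measurable (\<pi> k \<Otimes>\<^sub>M \<nu>)"
  proof (cases "i < k")
    case True
    then have "(\<lambda>z. fst z (i + 1)) \<in> borel_measurable (\<pi> k \<Otimes>\<^sub>M \<nu>)"
      using i by (intro measurable_compose[OF measurable_fst measurable_gauss_component]) auto
    with True i show ?thesis by (simp add: window_right_def)
  next
    case False
    with i show ?thesis by (simp add: window_right_def)
  qed
qed (simp add: window_right_def)

lemma window_left_measurable[measurable]: "window_left k \<in> measurable (\<pi> k \<Otimes>\<^sub>M \<nu>) (\<pi> k)"
proof (rule measurable_into_gauss)
  fix i assume i: "i \<in> {1..k}"
  show "(\<lambda>z. window_left k z i) \<in> borel_measurable (\<pi> k \<Otimes>\<^sub>M \<nu>)"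
  proof (cases "i = 1")
    case False
    then have "(\<lambda>z. fst z (i - 1)) \<in> borel_measurable (\<pi> k \<Otimes>\<^sub>M \<nu>)"
      using i by (intro measurable_compose[OF measurable_fst measurable_gauss_component]) auto
    with False i show ?thesis by (simp add: window_left_def)
  next
    case True
    with i show ?thesis by (simp add: window_left_def)
  qed
qed (simp add: window_left_def)

lemma rotate_window_measurable[measurable]:
  assumes "k \<ge> 1"
  shows "rotate_window k \<in> measurable (\<pi> k \<Otimes>\<^sub>M \<nu>) (\<pi> k \<Otimes>\<^sub>M \<nu>)"
proof -
  have "(\<lambda>z. fst z 1) \<in> measurable (\<pi> k \<Otimes>\<^sub>M \<nu>) \<nu>"
    using assms measurable_compose[OF measurable_fst measurable_gauss_component, of 1 k]
    by (simp cong: measurable_cong_sets)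
  then show ?thesis
    unfolding rotate_window_def by (rule measurable_Pair[OF window_right_measurable])
qed

lemma measurable_gauss_append[measurable]:
  "(\<lambda>z. (fst z)(Suc k := snd z)) \<in> measurable (\<pi> k \<Otimes>\<^sub>M \<nu>) (\<pi> (Suc k))"
proof -
  have ins: "insert (Suc k) {1..k} = {1..Suc k}" by auto
  have "(\<lambda>(x, X). X(Suc k := x)) \<in> measurable (\<nu> \<Otimes>\<^sub>M \<pi> k) (\<pi> (Suc k))"
    unfolding gauss_def ins[symmetric] by measurable
  from measurable_compose[OF measurable_pair_swap' this] show ?thesis
    by (simp add: case_prod_unfold)
qed

lemma distr_gauss_append:
  "distr (\<pi> k \<Otimes>\<^sub>M \<nu>) (\<pi> (Suc k)) (\<lambda>z. (fst z)(Suc k := snd z)) = \<pi> (Suc k)"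
proof -
  have ins: "insert (Suc k) {1..k} = {1..Suc k}" by auto
  interpret s: pair_sigma_finite \<nu> "\<pi> k" ..
  have "distr (\<pi> k \<Otimes>\<^sub>M \<nu>) (\<pi> (Suc k)) (\<lambda>z. (fst z)(Suc k := snd z)) =
        distr (\<nu> \<Otimes>\<^sub>M \<pi> k) (\<pi> (Suc k)) (\<lambda>(x, X). X(Suc k := x))"
    by (subst gauss_pair.distr_pair_swap, subst distr_distr[OF measurable_gauss_append])
      (auto simp: case_prod_unfold comp_def)
  also have "\<dots> = \<pi> (Suc k)"
    using distr_pair_PiM_eq_PiM[of "{1..k}" "\<lambda>_. \<nu>" "Suc k"]
    unfolding gauss_def ins by (simp add: prob_space_std_normal)
  finally show ?thesis .
qed

text \<open>Rotation is the cyclic shift of \<open>k + 1\<close> coordinates, the last of which is split off.\<close>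
lemma distr_rotate_window:
  assumes "k \<ge> 1"
  shows "distr (\<pi> k \<Otimes>\<^sub>M \<nu>) (\<pi> k \<Otimes>\<^sub>M \<nu>) (rotate_window k) = \<pi> k \<Otimes>\<^sub>M \<nu>"
proof -
  let ?app = "\<lambda>z. (fst z)(Suc k := snd z) :: nat \<Rightarrow> real"
  define split where "split \<omega> = (restrict \<omega> {1..k}, \<omega> (Suc k))" for \<omega> :: "nat \<Rightarrow> real"
  \<comment> \<open>A cyclic permutation of \<open>{1..Suc k}\<close>; reading the coordinates
    through it leaves a product of identical factors unchanged.\<close>
  define s where "s i = (if i = Suc k then 1 else Suc i)" for i
  define \<rho> where "\<rho> \<omega> = (\<lambda>i\<in>{1..Suc k}. \<omega> (s i))" for \<omega> :: "nat \<Rightarrow> real"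
  have s_in: "s i \<in> {1..Suc k}" if "i \<in> {1..Suc k}" for i
    using that by (auto simp: s_def)
  have restr: "(\<lambda>\<omega>. restrict \<omega> {1..k}) \<in> measurable (\<pi> (Suc k)) (\<pi> k)"
    by (rule measurable_into_gauss) auto
  have last: "(\<lambda>\<omega>. \<omega> (Suc k)) \<in> measurable (\<pi> (Suc k)) \<nu>"
    using measurable_gauss_component[of "Suc k" "Suc k"] by (simp cong: measurable_cong_sets)
  have [measurable]: "split \<in> measurable (\<pi> (Suc k)) (\<pi> k \<Otimes>\<^sub>M \<nu>)"
    unfolding split_def by (rule measurable_Pair[OF restr last])
  have [measurable]: "\<rho> \<in> measurable (\<pi> (Suc k)) (\<pi> (Suc k))"
    by (rule measurable_into_gauss) (auto simp: \<rho>_def intro!: measurable_gauss_component s_in)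
  have \<rho>: "distr (\<pi> (Suc k)) (\<pi> (Suc k)) \<rho> = \<pi> (Suc k)"
    unfolding gauss_def \<rho>_def
    by (rule distr_PiM_reindex) (auto simp: prob_space_std_normal inj_on_def s_def)
  have split_app: "distr (\<pi> k \<Otimes>\<^sub>M \<nu>) (\<pi> k \<Otimes>\<^sub>M \<nu>) (split \<circ> ?app) = \<pi> k \<Otimes>\<^sub>M \<nu>"
  proof -
    have "split (?app z) = z" if "z \<in> space (\<pi> k \<Otimes>\<^sub>M \<nu>)" for z
      using that by (auto simp: split_def space_pair_measure gauss_def space_PiM
          prod_eq_iff fun_eq_iff PiE_iff extensional_def restrict_def)
    then have "distr (\<pi> k \<Otimes>\<^sub>M \<nu>) (\<pi> k \<Otimes>\<^sub>M \<nu>) (split \<circ> ?app) = distr (\<pi> k \<Otimes>\<^sub>M \<nu>) (\<pi> k \<Otimes>\<^sub>M \<nu>) (\<lambda>z. z)"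
      by (intro distr_cong) auto
    then show ?thesis by simp
  qed
  have "distr (\<pi> k \<Otimes>\<^sub>M \<nu>) (\<pi> k \<Otimes>\<^sub>M \<nu>) (rotate_window k) =
        distr (\<pi> k \<Otimes>\<^sub>M \<nu>) (\<pi> k \<Otimes>\<^sub>M \<nu>) (split \<circ> (\<rho> \<circ> ?app))"
    using assms
    by (intro distr_cong) (auto simp: rotate_window_def split_def \<rho>_def s_def window_right_def fun_eq_iff)
  also have "\<dots> = distr (distr (distr (\<pi> k \<Otimes>\<^sub>M \<nu>) (\<pi> (Suc k)) ?app) (\<pi> (Suc k)) \<rho>) (\<pi> k \<Otimes>\<^sub>M \<nu>) split"
    by (subst distr_distr, measurable, subst distr_distr) (measurable, simp add: comp_assoc)
  also have "\<dots> = distr (distr (\<pi> k \<Otimes>\<^sub>M \<nu>) (\<pi> (Suc k)) ?app) (\<pi> k \<Otimes>\<^sub>M \<nu>) split"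
    by (simp add: distr_gauss_append \<rho>)
  also have "\<dots> = \<pi> k \<Otimes>\<^sub>M \<nu>"
    by (subst distr_distr) (measurable, simp add: split_app)
  finally show ?thesis .
qed

lemma distr_window_right:
  assumes "k \<ge> 1"
  shows "distr (\<pi> k \<Otimes>\<^sub>M \<nu>) (\<pi> k) (window_right k) = \<pi> k"
proof -
  have "distr (distr (\<pi> k \<Otimes>\<^sub>M \<nu>) (\<pi> k \<Otimes>\<^sub>M \<nu>) (rotate_window k)) (\<pi> k) fst
      = distr (\<pi> k \<Otimes>\<^sub>M \<nu>) (\<pi> k) (fst \<circ> rotate_window k)"
    using rotate_window_measurable[OF assms] by (intro distr_distr) auto
  moreover have "fst \<circ> rotate_window k = window_right k"
    by (auto simp: rotate_window_def)
  ultimately show ?thesis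
    using distr_rotate_window[OF assms] by (simp add: std_normal.distr_pair_fst)
qed

lemma window_left_rotate_window:
  assumes "k \<ge> 1" "z \<in> space (\<pi> k \<Otimes>\<^sub>M \<nu>)"
  shows "window_left k (rotate_window k z) = fst z"
proof
  fix i
  \<comment> \<open>For indices outside \<open>{1..k}\<close> both sides must agree on the default
    value.\<close>
  have "fst z \<in> extensional {1..k}"
    using assms(2) by (auto simp: space_pair_measure gauss_def space_PiM PiE_def)
  then show "window_left k (rotate_window k z) i = fst z i"
    using assms(1)
    by (auto simp: window_left_def rotate_window_def window_right_def extensional_def)
qed

text \<open>By invariance the pair may be replaced by its rotation, after which the left window is
  the original first component.\<close>

lemma distr_window_left:
  assumes "k \<ge> 1"
  shows "distr (\<pi> k \<Otimes>\<^sub>M \<nu>) (\<pi> k) (window_left k) = \<pi> k"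
proof -
  have "distr (distr (\<pi> k \<Otimes>\<^sub>M \<nu>) (\<pi> k \<Otimes>\<^sub>M \<nu>) (rotate_window k)) (\<pi> k) (window_left k)
      = distr (\<pi> k \<Otimes>\<^sub>M \<nu>) (\<pi> k) (window_left k \<circ> rotate_window k)"
    using rotate_window_measurable[OF assms] by (intro distr_distr) auto
  also have "\<dots> = distr (\<pi> k \<Otimes>\<^sub>M \<nu>) (\<pi> k) fst"
    using assms by (intro distr_cong) (auto simp: window_left_rotate_window)
  finally show ?thesis
    using distr_rotate_window[OF assms] by (simp add: std_normal.distr_pair_fst)
qed

text \<open>An explicit representative of the adjoint of \<open>P k\<close>, where a fresh variable
  enters at the left end. It supplies the existence behind the \<open>SOME\<close> in
  \<open>P_adj\<close> and can be evaluated on monomials.\<close>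

definition Q :: "nat \<Rightarrow> ((nat \<Rightarrow> real) \<Rightarrow> real) \<Rightarrow> (nat \<Rightarrow> real) \<Rightarrow> real"
  where "Q k f = (\<lambda>x. LINT \<xi>|\<nu>. f (window_left k (x, \<xi>)))"

lemma P_eq: "P k f = (\<lambda>x. LINT \<xi>|\<nu>. f (window_right k (x, \<xi>)))"
  by (simp only: P_def window_right_def fst_conv snd_conv)

lemma mean_zero_L2D:
  assumes "f \<in> \<H> k"
  shows "f \<in> borel_measurable (\<pi> k)" "integrable (\<pi> k) (\<lambda>x. (f x)\<^sup>2)" "integral\<^sup>L (\<pi> k) f = 0"
  using assms by (auto simp: mean_zero_L2_def)

lemma comp_measure_preserving:
  fixes \<phi> :: "(nat \<Rightarrow> real) \<times> real \<Rightarrow> nat \<Rightarrow> real"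
  assumes \<phi>: "\<phi> \<in> measurable (\<pi> k \<Otimes>\<^sub>M \<nu>) (\<pi> k)" "distr (\<pi> k \<Otimes>\<^sub>M \<nu>) (\<pi> k) \<phi> = \<pi> k"
    and f: "f \<in> \<H> k"
  shows "(\<lambda>z. f (\<phi> z)) \<in> borel_measurable (\<pi> k \<Otimes>\<^sub>M \<nu>)"
    and "integrable (\<pi> k \<Otimes>\<^sub>M \<nu>) (\<lambda>z. (f (\<phi> z))\<^sup>2)"
    and "(\<integral>z. f (\<phi> z) \<partial>(\<pi> k \<Otimes>\<^sub>M \<nu>)) = 0"
proof -
  note [measurable] = \<phi>(1) mean_zero_L2D(1)[OF f]
  show "(\<lambda>z. f (\<phi> z)) \<in> borel_measurable (\<pi> k \<Otimes>\<^sub>M \<nu>)" by measurable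
  have "integrable (distr (\<pi> k \<Otimes>\<^sub>M \<nu>) (\<pi> k) \<phi>) (\<lambda>x. (f x)\<^sup>2)"
    by (simp add: \<phi>(2) mean_zero_L2D(2)[OF f])
  then show "integrable (\<pi> k \<Otimes>\<^sub>M \<nu>) (\<lambda>z. (f (\<phi> z))\<^sup>2)"
    by (subst (asm) integrable_distr_eq) auto
  have "(\<integral>z. f (\<phi> z) \<partial>(\<pi> k \<Otimes>\<^sub>M \<nu>)) = integral\<^sup>L (distr (\<pi> k \<Otimes>\<^sub>M \<nu>) (\<pi> k) \<phi>) f"
    by (subst integral_distr) auto
  then show "(\<integral>z. f (\<phi> z) \<partial>(\<pi> k \<Otimes>\<^sub>M \<nu>)) = 0"
    by (simp add: \<phi>(2) mean_zero_L2D(3)[OF f])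
qed

text \<open>Covers \<open>P\<close> and \<open>Q\<close> at once: averaging over the spare variable
  keeps the mean by Fubini and square integrability by Jensen.\<close>

lemma mean_zero_L2_partial_integral:
  fixes \<phi> :: "(nat \<Rightarrow> real) \<times> real \<Rightarrow> nat \<Rightarrow> real"
  assumes \<phi>: "\<phi> \<in> measurable (\<pi> k \<Otimes>\<^sub>M \<nu>) (\<pi> k)" "distr (\<pi> k \<Otimes>\<^sub>M \<nu>) (\<pi> k) \<phi> = \<pi> k"
    and f: "f \<in> \<H> k"
  shows "(\<lambda>x. \<integral>\<xi>. f (\<phi> (x, \<xi>)) \<partial>\<nu>) \<in> \<H> k"
proof -
  note F = comp_measure_preserving[OF assms]
  note [measurable] = F(1)
  have "(\<integral>x. (\<integral>\<xi>. f (\<phi> (x, \<xi>)) \<partial>\<nu>) \<partial>\<pi> k) = 0"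
    using gauss_pair.integral_mult_partial_integral[OF F(1,2), of "\<lambda>_. 1"] F(3) by simp
  moreover have "(\<lambda>x. \<integral>\<xi>. f (\<phi> (x, \<xi>)) \<partial>\<nu>) \<in> borel_measurable (\<pi> k)"
    by (rule std_normal.borel_measurable_lebesgue_integral) simp
  ultimately show ?thesis
    using gauss_pair.partial_integral_square[OF F(1,2)] by (simp add: mean_zero_L2_def)
qed

lemma P_mean_zero_L2: "k \<ge> 1 \<Longrightarrow> f \<in> \<H> k \<Longrightarrow> P k f \<in> \<H> k"
  unfolding P_eq by (intro mean_zero_L2_partial_integral window_right_measurable distr_window_right)

lemma Q_mean_zero_L2: "k \<ge> 1 \<Longrightarrow> f \<in> \<H> k \<Longrightarrow> Q k f \<in> \<H> k"
  unfolding Q_def by (intro mean_zero_L2_partial_integral window_left_measurable distr_window_left)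

lemma inner_prod_commute: "inner_prod k f g = inner_prod k g f"
  by (simp add: inner_prod_def mult.commute)

text \<open>Change of variables along \<open>rotate_window\<close>, which turns the left window into
  the first component and the first component into the right window.\<close>

lemma inner_prod_P:
  assumes k: "k \<ge> 1" and f: "f \<in> \<H> k" and g: "g \<in> \<H> k"
  shows "inner_prod k (P k g) f = inner_prod k g (Q k f)"
proof -
  let ?M = "\<pi> k \<Otimes>\<^sub>M \<nu>"
  note R = comp_measure_preserving[OF window_right_measurable distr_window_right[OF k] g]
  note L = comp_measure_preserving[OF window_left_measurable distr_window_left[OF k] f]
  note [measurable] = R(1) L(1) mean_zero_L2D(1)[OF f] mean_zero_L2D(1)[OF g] rotate_window_measurable[OF k]
  have "inner_prod k g (Q k f) = (\<integral>z. g (fst z) * f (window_left k z) \<partial>?M)"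
    unfolding inner_prod_def Q_def
    by (rule gauss_pair.integral_mult_partial_integral[OF L(1,2) mean_zero_L2D(1,2)[OF g]])
  also have "\<dots> = (\<integral>z. g (fst z) * f (window_left k z) \<partial>distr ?M ?M (rotate_window k))"
    by (simp add: distr_rotate_window[OF k])
  also have "\<dots> = (\<integral>z. g (fst (rotate_window k z)) * f (window_left k (rotate_window k z)) \<partial>?M)"
    by (rule integral_distr) measurable
  also have "\<dots> = (\<integral>z. f (fst z) * g (window_right k z) \<partial>?M)"
    using k by (intro Bochner_Integration.integral_cong) (auto simp: window_left_rotate_window, simp add: rotate_window_def)
  also have "\<dots> = inner_prod k f (P k g)"
    unfolding inner_prod_def P_eq
    by (rule gauss_pair.integral_mult_partial_integral[OF R(1,2) mean_zero_L2D(1,2)[OF f], symmetric])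
  finally show ?thesis by (simp add: inner_prod_commute)
qed

text \<open>\<open>Q k f\<close> witnesses that the choice in \<open>P_adj\<close> is possible. From
  here on only the adjoint identity is used, never the chosen representative.\<close>

lemma P_adj_properties:
  assumes "k \<ge> 1" "f \<in> \<H> k"
  shows P_adj_mean_zero_L2: "P_adj k f \<in> \<H> k"
    and inner_prod_P_adj: "\<And>g. g \<in> \<H> k \<Longrightarrow> inner_prod k (P k g) f = inner_prod k g (P_adj k f)"
proof -
  have "\<exists>h. h \<in> \<H> k \<and> (\<forall>g\<in>\<H> k. inner_prod k (P k g) f = inner_prod k g h)"
    using assms by (intro exI[of _ "Q k f"]) (auto simp: inner_prod_P Q_mean_zero_L2)
  from someI_ex[OF this] show "P_adj k f \<in> \<H> k"
    "\<And>g. g \<in> \<H> k \<Longrightarrow> inner_prod k (P k g) f = inner_prod k g (P_adj k f)"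
    unfolding P_adj_def by auto
qed

lemma P_power_mean_zero_L2: "k \<ge> 1 \<Longrightarrow> f \<in> \<H> k \<Longrightarrow> (P k ^^ r) f \<in> \<H> k"
  by (induction r) (auto simp: P_mean_zero_L2)

lemma P_adj_power_mean_zero_L2: "k \<ge> 1 \<Longrightarrow> f \<in> \<H> k \<Longrightarrow> (P_adj k ^^ r) f \<in> \<H> k"
  by (induction r) (auto simp: P_adj_mean_zero_L2)

section \<open>Linear structure and inner product of the mean-zero functions\<close>

lemma inner_prod_cong_AE:
  assumes "f \<in> borel_measurable (\<pi> k)" "g \<in> borel_measurable (\<pi> k)" "g' \<in> borel_measurable (\<pi> k)"
    and "AE x in \<pi> k. g x = g' x"
  shows "inner_prod k f g = inner_prod k f g'"
  unfolding inner_prod_def using assms by (intro integral_cong_AE) auto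

lemma integrable_mult_mean_zero_L2:
  "f \<in> \<H> k \<Longrightarrow> g \<in> \<H> k \<Longrightarrow> integrable (\<pi> k) (\<lambda>x. f x * g x)"
  by (intro integrable_mult_of_squares mean_zero_L2D)

lemma mean_zero_L2_add:
  assumes f: "f \<in> \<H> k" and g: "g \<in> \<H> k"
  shows "(\<lambda>x. f x + g x) \<in> \<H> k"
proof -
  note [measurable] = mean_zero_L2D(1)[OF f] mean_zero_L2D(1)[OF g]
  have "integrable (\<pi> k) (\<lambda>x. (f x)\<^sup>2 + (g x)\<^sup>2 + 2 * (f x * g x))"
    using integrable_mult_mean_zero_L2[OF f g] mean_zero_L2D(2)[OF f] mean_zero_L2D(2)[OF g] by simp
  moreover have "integrable (\<pi> k) f" "integrable (\<pi> k) g"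
    using f g by (auto intro: gauss.square_integrable_imp_integrable dest: mean_zero_L2D)
  ultimately show ?thesis
    using mean_zero_L2D(3)[OF f] mean_zero_L2D(3)[OF g]
    by (simp add: mean_zero_L2_def power2_sum mult.assoc)
qed

lemma mean_zero_L2_sum:
  "finite A \<Longrightarrow> (\<And>i. i \<in> A \<Longrightarrow> f i \<in> \<H> k) \<Longrightarrow> (\<lambda>x. \<Sum>i\<in>A. f i x) \<in> \<H> k"
proof (induction A rule: finite_induct)
  case empty
  then show ?case by (simp add: mean_zero_L2_def)
next
  case (insert i A)
  then show ?case by (simp add: mean_zero_L2_add)
qed

lemma inner_prod_add_right:
  "f \<in> \<H> k \<Longrightarrow> g \<in> \<H> k \<Longrightarrow> h \<in> \<H> k \<Longrightarrow>
    inner_prod k f (\<lambda>x. g x + h x) = inner_prod k f g + inner_prod k f h"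
  by (simp add: inner_prod_def distrib_left integrable_mult_mean_zero_L2)

lemma inner_prod_diff_left:
  "f \<in> \<H> k \<Longrightarrow> g \<in> \<H> k \<Longrightarrow> h \<in> \<H> k \<Longrightarrow>
    inner_prod k (\<lambda>x. g x - h x) f = inner_prod k g f - inner_prod k h f"
  by (simp add: inner_prod_def left_diff_distrib integrable_mult_mean_zero_L2)

lemma inner_prod_sum_right:
  assumes "f \<in> \<H> k" "\<And>i. i \<in> A \<Longrightarrow> g i \<in> \<H> k"
  shows "inner_prod k f (\<lambda>x. \<Sum>i\<in>A. g i x) = (\<Sum>i\<in>A. inner_prod k f (g i))"
  using assms by (simp add: inner_prod_def sum_distrib_left integrable_mult_mean_zero_L2)

lemma inner_prod_sum_left:
  assumes "f \<in> \<H> k" "\<And>i. i \<in> A \<Longrightarrow> g i \<in> \<H> k"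
  shows "inner_prod k (\<lambda>x. \<Sum>i\<in>A. g i x) f = (\<Sum>i\<in>A. inner_prod k (g i) f)"
  using inner_prod_sum_right[OF assms] by (simp add: inner_prod_commute)

lemma inner_prod_self_eq_0:
  assumes f: "f \<in> \<H> k" and "inner_prod k f f = 0"
  shows "AE x in \<pi> k. f x = 0"
proof -
  have "integral\<^sup>L (\<pi> k) (\<lambda>x. (f x)\<^sup>2) = 0"
    using assms(2) by (simp add: inner_prod_def power2_eq_square)
  then show ?thesis
    by (subst (asm) integral_nonneg_eq_0_iff_AE) (auto simp: mean_zero_L2D(2)[OF f])
qed

section \<open>Square-free monomials\<close>

definition xprod :: "nat set \<Rightarrow> (nat \<Rightarrow> real) \<Rightarrow> real"
  where "xprod I x = (\<Prod>i\<in>I. x i)"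

lemma elem_sym_eq: "elem_sym l k x = (\<Sum>I | I \<subseteq> {1..k} \<and> card I = l. xprod I x)"
  by (simp add: elem_sym_def xprod_def)

lemma xprod_measurable: "A \<subseteq> {1..k} \<Longrightarrow> xprod A \<in> borel_measurable (\<pi> k)"
  unfolding xprod_def by (intro borel_measurable_prod measurable_gauss_component) auto

text \<open>Fubini factors the integral over the coordinates: an index in both sets contributes the
  second moment 1, one in neither set the total mass 1, one in exactly one set the mean 0.\<close>

lemma xprod_orthonormal:
  assumes A: "A \<subseteq> {1..k}" and C: "C \<subseteq> {1..k}"
  shows "integrable (\<pi> k) (\<lambda>x. xprod A x * xprod C x)"
    and "(\<integral>x. xprod A x * xprod C x \<partial>\<pi> k) = (if A = C then 1 else 0)"
proof -
  define f where "f i y = (if i \<in> A then y else 1) * (if i \<in> C then y else 1)" for i and y :: real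
  have xprod_eq: "xprod J x = (\<Prod>i=1..k. if i \<in> J then x i else 1)" if "J \<subseteq> {1..k}" for J x
    using that prod.inter_restrict[of "{1..k}" x J] by (simp add: xprod_def Int_absorb1)
  have eq: "(\<lambda>x. xprod A x * xprod C x) = (\<lambda>x. \<Prod>i=1..k. f i (x i))"
    by (simp add: xprod_eq[OF A] xprod_eq[OF C] f_def prod.distrib)
  have f_cases: "f i = (if i \<in> A then (if i \<in> C then (\<lambda>y. y\<^sup>2) else (\<lambda>y. y))
      else if i \<in> C then (\<lambda>y. y) else (\<lambda>_. 1))" for i
    by (rule ext) (simp add: f_def power2_eq_square)
  have f: "integrable \<nu> (f i)" for i
    by (simp add: f_cases std_normal_mean std_normal_second_moment)
  show "integrable (\<pi> k) (\<lambda>x. xprod A x * xprod C x)"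
    unfolding eq gauss_def by (rule std_normal_prod.product_integrable_prod) (auto simp: f)
  have int_f: "integral\<^sup>L \<nu> (f i) = (if i \<in> A \<longleftrightarrow> i \<in> C then 1 else 0)" for i
    by (simp add: f_cases std_normal_mean std_normal_second_moment std_normal.prob_space[simplified])
  have "(\<integral>x. xprod A x * xprod C x \<partial>\<pi> k) = (\<Prod>i=1..k. integral\<^sup>L \<nu> (f i))"
    unfolding eq gauss_def by (rule std_normal_prod.product_integral_prod) (auto simp: f)
  also have "\<dots> = (if A = C then 1 else 0)"
  proof (cases "A = C")
    case False
    then obtain i where "i \<in> {1..k}" "(i \<in> A) \<noteq> (i \<in> C)"
      using A C by blast
    then have "(\<Prod>i=1..k. integral\<^sup>L \<nu> (f i)) = 0"
      by (intro prod_zero) (auto simp: int_f intro!: bexI[of _ i])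
    with False show ?thesis by simp
  qed (simp add: int_f)
  finally show "(\<integral>x. xprod A x * xprod C x \<partial>\<pi> k) = (if A = C then 1 else 0)" .
qed

lemma xprod_mean_zero_L2:
  assumes "A \<subseteq> {1..k}" "A \<noteq> {}"
  shows "xprod A \<in> \<H> k"
proof -
  have "integrable (\<pi> k) (\<lambda>x. (xprod A x)\<^sup>2)"
    using xprod_orthonormal(1)[OF assms(1) assms(1)] by (simp add: power2_eq_square)
  \<comment> \<open>The mean is the inner product with the empty monomial, the constant 1.\<close>
  moreover have "integral\<^sup>L (\<pi> k) (xprod A) = 0"
    using xprod_orthonormal(2)[OF assms(1), of "{}"] assms(2) by (simp add: xprod_def[of "{}"])
  ultimately show ?thesis
    using xprod_measurable[OF assms(1)] by (simp add: mean_zero_L2_def)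
qed

text \<open>By orthonormality, norms and covariances of such sums reduce to counting.\<close>

lemma inner_prod_sum_xprod:
  assumes "finite F" "finite G" "F \<union> G \<subseteq> Pow {1..k} - {{}}"
  shows "inner_prod k (\<lambda>x. \<Sum>I\<in>F. xprod I x) (\<lambda>x. \<Sum>J\<in>G. xprod J x) = card (F \<inter> G)"
proof -
  have H: "xprod I \<in> \<H> k" if "I \<in> F \<union> G" for I
    using that assms(3) by (intro xprod_mean_zero_L2) auto
  have "inner_prod k (\<lambda>x. \<Sum>I\<in>F. xprod I x) (\<lambda>x. \<Sum>J\<in>G. xprod J x)
      = (\<Sum>I\<in>F. \<Sum>J\<in>G. inner_prod k (xprod I) (xprod J))"
    using H assms by (subst inner_prod_sum_left) (auto intro!: mean_zero_L2_sum sum.cong inner_prod_sum_right)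
  also have "\<dots> = (\<Sum>I\<in>F. \<Sum>J\<in>G. if I = J then 1 else 0)"
    unfolding inner_prod_def using assms(3)
    by (intro sum.cong xprod_orthonormal(2) refl) auto
  also have "\<dots> = card (F \<inter> G)"
    using assms by (simp add: sum.inter_restrict[symmetric])
  finally show ?thesis .
qed

text \<open>The integrand is linear in the fresh variable, which has mean 0. Stated for general
  \<open>f\<close> so as to serve single monomials and their sums alike.\<close>

lemma P_eq_0:
  assumes "\<And>\<xi>. f (window_right k (x, \<xi>)) = \<xi> * c"
  shows "P k f x = 0"
  using std_normal_mean(2) by (simp add: P_eq assms)

lemma Q_eq_0:
  assumes "\<And>\<xi>. f (window_left k (x, \<xi>)) = \<xi> * c"
  shows "Q k f x = 0"
  using std_normal_mean(2) by (simp add: Q_def assms)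

text \<open>Position \<open>i < k\<close> of the new window shows the old coordinate
  \<open>i + 1\<close>, so indices move up by one; position \<open>k\<close> shows the fresh
  variable, which splits off as a factor.\<close>

lemma xprod_window_right:
  assumes "J \<subseteq> {1..k}"
  shows "xprod J (window_right k (x, \<xi>)) =
    (if k \<in> J then \<xi> * xprod (Suc ` (J - {k})) x else xprod (Suc ` J) x)"
proof -
  have fin: "finite J" using assms finite_subset by blast
  have *: "(\<Prod>i\<in>K. window_right k (x, \<xi>) i) = xprod (Suc ` K) x" if "K \<subseteq> {1..<k}" for K
    unfolding xprod_def using that
    by (subst prod.reindex) (auto simp: window_right_def intro!: prod.cong)
  show ?thesis
  proof (cases "k \<in> J")
    case True
    have "J - {k} \<subseteq> {1..<k}" using assms by force
    with True assms fin * show ?thesis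
      by (auto simp: xprod_def prod.remove[of J k] window_right_def[of k "(x, \<xi>)"])
  next
    case False
    then have "J \<subseteq> {1..<k}" using assms by (auto simp: less_le)
    with False * show ?thesis by (simp add: xprod_def[of J])
  qed
qed

lemma xprod_window_left:
  assumes "J \<subseteq> {1..k}"
  shows "xprod J (window_left k (x, \<xi>)) =
    (if 1 \<in> J then \<xi> * xprod ((\<lambda>i. i - 1) ` (J - {1})) x else xprod ((\<lambda>i. i - 1) ` J) x)"
proof -
  have fin: "finite J" using assms finite_subset by blast
  have *: "(\<Prod>i\<in>K. window_left k (x, \<xi>) i) = xprod ((\<lambda>i. i - 1) ` K) x" if "K \<subseteq> {2..k}" for K
    unfolding xprod_def using that
    by (subst prod.reindex) (auto simp: window_left_def inj_on_def subset_eq intro!: prod.cong)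
  show ?thesis
  proof (cases "1 \<in> J")
    case True
    have "J - {1} \<subseteq> {2..k}" using assms by force
    from *[OF this] True assms fin show ?thesis
      by (auto simp: xprod_def prod.remove[of J 1] window_left_def[of k "(x, \<xi>)"])
  next
    case False
    have "J \<subseteq> {2..k}"
    proof
      fix i assume "i \<in> J"
      moreover have "i \<noteq> 1" using \<open>i \<in> J\<close> False by auto
      ultimately show "i \<in> {2..k}" using assms by force
    qed
    with False * show ?thesis by (simp add: xprod_def[of J])
  qed
qed

lemma P_xprod:
  assumes "J \<subseteq> {1..k}"
  shows "P k (xprod J) = (if k \<in> J then (\<lambda>_. 0) else xprod (Suc ` J))"
proof (cases "k \<in> J")
  case True
  have "P k (xprod J) x = 0" for x
    by (rule P_eq_0[where c = "xprod (Suc ` (J - {k})) x"]) (simp add: xprod_window_right[OF assms] True)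
  with True show ?thesis by auto
next
  case False
  then show ?thesis
    by (simp add: P_eq xprod_window_right[OF assms] std_normal.prob_space[simplified])
qed

lemma Q_xprod:
  assumes "J \<subseteq> {1..k}"
  shows "Q k (xprod J) = (if 1 \<in> J then (\<lambda>_. 0) else xprod ((\<lambda>i. i - 1) ` J))"
proof (cases "1 \<in> J")
  case True
  have "Q k (xprod J) x = 0" for x
    by (rule Q_eq_0[where c = "xprod ((\<lambda>i. i - 1) ` (J - {1})) x"])
      (use True in \<open>simp add: xprod_window_left[OF assms]\<close>)
  with True show ?thesis by auto
next
  case False
  then show ?thesis
    by (simp add: Q_def xprod_window_left[OF assms] std_normal.prob_space[simplified])
qed

section \<open>The eigenspace for eigenvalue 1\<close>

text \<open>
  The coefficients of \<open>h\<close> along the translates of a pattern \<open>D \<subseteq> {0..d}\<close> that contains \<open>0\<close>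
  and \<open>d\<close>; those that do not fit into \<open>{1..k}\<close> count as \<open>0\<close>.
\<close>
definition shift_coeff :: "nat \<Rightarrow> nat set \<Rightarrow> nat \<Rightarrow> ((nat \<Rightarrow> real) \<Rightarrow> real) \<Rightarrow> nat \<Rightarrow> real"
  where "shift_coeff k D d h i =
    (if 1 \<le> i \<and> i + d \<le> k then inner_prod k (xprod ((+) i ` D)) h else 0)"

lemma shift_subset:
  assumes "(D::nat set) \<subseteq> {0..d}" "1 \<le> i" "i + d \<le> k"
  shows "(+) i ` D \<subseteq> {1..k}"
  using assms by force

text \<open>Taking the inner product with \<open>P k h\<close> moves \<open>Q\<close> onto the
  monomial, which slides one place to the left. For \<open>i = 1\<close> the monomial contains
  \<open>x 1\<close> because \<open>0 \<in> D\<close>, so \<open>Q\<close> kills it, in agreement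
  with the default value 0 at index 0.\<close>

lemma shift_coeff_P:
  assumes D: "D \<subseteq> {0..d}" "0 \<in> D" and k: "k \<ge> 1" and h: "h \<in> \<H> k" and i: "i + d \<le> k"
  shows "shift_coeff k D d (P k h) i = shift_coeff k D d h (i - 1)"
proof (cases "1 \<le> i")
  case True
  then have sub: "(+) i ` D \<subseteq> {1..k}" using D(1) i by (intro shift_subset)
  have "inner_prod k (xprod ((+) i ` D)) (P k h) = inner_prod k (Q k (xprod ((+) i ` D))) h"
    using inner_prod_P[OF k xprod_mean_zero_L2[OF sub] h] D(2)
    by (subst (1 2) inner_prod_commute) auto
  moreover have "1 \<in> (+) i ` D \<longleftrightarrow> i = 1" using True D(2) by auto
  moreover have "(\<lambda>j. j - 1) ` (+) i ` D = (+) (i - 1) ` D"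
    using True by (auto simp: image_image intro!: image_cong)
  ultimately show ?thesis
    using True i by (auto simp: shift_coeff_def Q_xprod[OF sub] inner_prod_def)
qed (simp add: shift_coeff_def)

text \<open>Here \<open>P\<close> slides the monomial to the right. At \<open>i + d = k\<close> it
  contains \<open>x k\<close> because \<open>d \<in> D\<close> and is killed, matching the default
  value 0 beyond the last translate.\<close>

lemma shift_coeff_P_adj:
  assumes D: "D \<subseteq> {0..d}" "d \<in> D" and k: "k \<ge> 1" and h: "h \<in> \<H> k" and i: "i \<ge> 1"
  shows "shift_coeff k D d (P_adj k h) i = shift_coeff k D d h (i + 1)"
proof (cases "i + d \<le> k")
  case True
  then have sub: "(+) i ` D \<subseteq> {1..k}" using D(1) i by (intro shift_subset) auto
  have "inner_prod k (xprod ((+) i ` D)) (P_adj k h) = inner_prod k (P k (xprod ((+) i ` D))) h"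
    using inner_prod_P_adj[OF k h xprod_mean_zero_L2[OF sub]] D(2) by force
  moreover have "k \<in> (+) i ` D \<longleftrightarrow> i + d = k" using True D by force
  moreover have "Suc ` (+) i ` D = (+) (i + 1) ` D"
    by (simp add: image_image)
  ultimately show ?thesis
    using True i by (auto simp: shift_coeff_def P_xprod[OF sub] inner_prod_def)
qed (simp add: shift_coeff_def)

text \<open>Truncated subtraction is harmless: an index that reaches 0 stays there, and its
  coefficient is 0.\<close>

lemma shift_coeff_P_power:
  assumes "D \<subseteq> {0..d}" "0 \<in> D" "k \<ge> 1" "h \<in> \<H> k" "i + d \<le> k"
  shows "shift_coeff k D d ((P k ^^ r) h) i = shift_coeff k D d h (i - r)"
  using assms
  by (induction r arbitrary: i) (simp_all add: shift_coeff_P P_power_mean_zero_L2)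

lemma shift_coeff_P_adj_power:
  assumes "D \<subseteq> {0..d}" "d \<in> D" "k \<ge> 1" "h \<in> \<H> k" "i \<ge> 1"
  shows "shift_coeff k D d ((P_adj k ^^ r) h) i = shift_coeff k D d h (i + r)"
  using assms
  by (induction r arbitrary: i) (simp_all add: shift_coeff_P_adj P_adj_power_mean_zero_L2)

text \<open>From \<open>i\<close>, steps of length \<open>r\<close> in both directions reach every
  other \<open>j\<close> in \<open>{1..n}\<close> exactly once, and whatever lies outside carries
  the value 0. As \<open>n \<le> k\<close>, lengths up to \<open>k - 1\<close> suffice.\<close>

lemma sum_translates:
  fixes b :: "nat \<Rightarrow> real"
  assumes b: "\<And>j. j = 0 \<or> j > n \<Longrightarrow> b j = 0" and "n \<le> k" "i \<in> {1..n}"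
  shows "(\<Sum>r=1..k-1. b (i - r) + b (i + r)) = (\<Sum>j=1..n. b j) - b i"
proof -
  have "(\<Sum>r=1..k-1. b (i - r)) = (\<Sum>r=1..i-1. b (i - r))"
    using assms by (intro sum.mono_neutral_right) auto
  also have "\<dots> = (\<Sum>j=1..i-1. b j)"
    by (rule sum.reindex_bij_witness[of _ "\<lambda>j. i - j" "\<lambda>r. i - r"]) auto
  finally have 1: "(\<Sum>r=1..k-1. b (i - r)) = (\<Sum>j=1..i-1. b j)" .
  have "(\<Sum>r=1..k-1. b (i + r)) = (\<Sum>r=1..n-i. b (i + r))"
    using assms by (intro sum.mono_neutral_right) (auto intro!: b)
  also have "\<dots> = (\<Sum>j=i+1..n. b j)"
    by (rule sum.reindex_bij_witness[of _ "\<lambda>j. j - i" "\<lambda>r. i + r"]) auto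
  finally have 2: "(\<Sum>r=1..k-1. b (i + r)) = (\<Sum>j=i+1..n. b j)" .
  have "{1..n} - {i} = {1..i-1} \<union> {i+1..n}"
    using assms(3) by auto
  then have "(\<Sum>j=1..n. b j) - b i = (\<Sum>j=1..i-1. b j) + (\<Sum>j=i+1..n. b j)"
    using assms(3) by (subst sum.remove[of _ i]) (auto simp: sum.union_disjoint)
  then show ?thesis
    by (simp only: sum.distrib 1 2)
qed

lemma inner_prod_B:
  assumes k: "k \<ge> 1" and f: "f \<in> \<H> k" and h: "h \<in> \<H> k"
  shows "inner_prod k f (B k h) = inner_prod k f h +
    (\<Sum>r=1..k-1. inner_prod k f ((P k ^^ r) h) + inner_prod k f ((P_adj k ^^ r) h))"
proof -
  note PH = P_power_mean_zero_L2[OF k h] and P_adjH = P_adj_power_mean_zero_L2[OF k h]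
  have "inner_prod k f (B k h) =
      inner_prod k f h + inner_prod k f (\<lambda>x. \<Sum>r=1..k-1. (P k ^^ r) h x + (P_adj k ^^ r) h x)"
    unfolding B_def
    by (intro inner_prod_add_right mean_zero_L2_sum mean_zero_L2_add PH P_adjH f h) simp
  also have "inner_prod k f (\<lambda>x. \<Sum>r=1..k-1. (P k ^^ r) h x + (P_adj k ^^ r) h x) =
      (\<Sum>r=1..k-1. inner_prod k f (\<lambda>x. (P k ^^ r) h x + (P_adj k ^^ r) h x))"
    by (intro inner_prod_sum_right mean_zero_L2_add PH P_adjH f)
  also have "\<dots> = (\<Sum>r=1..k-1. inner_prod k f ((P k ^^ r) h) + inner_prod k f ((P_adj k ^^ r) h))"
    by (intro sum.cong refl inner_prod_add_right PH P_adjH f)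
  finally show ?thesis .
qed

lemma B_mean_zero_L2: "k \<ge> 1 \<Longrightarrow> h \<in> \<H> k \<Longrightarrow> B k h \<in> \<H> k"
  unfolding B_def
  by (intro mean_zero_L2_add mean_zero_L2_sum P_power_mean_zero_L2 P_adj_power_mean_zero_L2) auto

text \<open>
  On \<open>\<L>\<^sub>1\<close> the coefficients along the translates of a pattern satisfy \<open>b i = \<Sum>j. b j\<close> for every
  \<open>i\<close>; as soon as there are two translates this forces all of them to vanish.
\<close>
lemma inner_prod_xprod_eigenspace_one:
  assumes h: "h \<in> \<L>\<^sub>1 k" and I: "I \<subseteq> {1..k}" "I \<noteq> {}" and not_ends: "\<not> (1 \<in> I \<and> k \<in> I)"
  shows "inner_prod k (xprod I) h = 0"
proof -
  have finI: "finite I" using I finite_subset by blast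
  \<comment> \<open>\<open>I\<close> is normalised to a pattern \<open>D\<close> that starts at 0
    and ends at its span \<open>d\<close>; then \<open>n\<close> is the number of translates of
    \<open>D\<close> inside \<open>{1..k}\<close>.\<close>
  define m where "m = Min I"
  define d where "d = Max I - m"
  define n where "n = k - d"
  define D where "D = (\<lambda>i. i - m) ` I"
  define b where "b = shift_coeff k D d h"
  have hH: "h \<in> \<H> k" and Bh: "AE x in \<pi> k. B k h x = h x"
    using h by (auto simp: eigenspace_one_def)
  have m: "m \<in> I" "\<And>i. i \<in> I \<Longrightarrow> m \<le> i" and M: "Max I \<in> I" "\<And>i. i \<in> I \<Longrightarrow> i \<le> Max I"
    using finI I(2) by (auto simp: m_def)
  have md: "1 \<le> m" "m + d \<le> k" "m + d = Max I"
    using m M I(1) by (auto simp: d_def)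
  then have k: "k \<ge> 1" by simp
  have D: "D \<subseteq> {0..d}" "0 \<in> D" "d \<in> D"
    using m M md by (auto simp: D_def d_def image_iff intro!: diff_le_mono)
  have ID: "(+) m ` D = I"
    using m(2) by (force simp: D_def image_image)
  \<comment> \<open>Only an index set reaching from 1 to \<open>k\<close> has a single
    translate.\<close>
  have n2: "n \<ge> 2"
  proof (rule ccontr)
    assume "\<not> n \<ge> 2"
    then have "m = 1" "Max I = k" using md by (auto simp: n_def)
    then show False using not_ends m(1) M(1) by auto
  qed
  have b_eq: "(\<Sum>j=1..n. b j) = b i" if i: "i \<in> {1..n}" for i
  proof -
    have i': "1 \<le> i \<and> i + d \<le> k" using i n2 by (auto simp: n_def)
    have x: "xprod ((+) i ` D) \<in> \<H> k"
      using D i' by (intro xprod_mean_zero_L2 shift_subset[of D d]) auto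
    have "inner_prod k (xprod ((+) i ` D)) (B k h) = inner_prod k (xprod ((+) i ` D)) h"
      using Bh by (intro inner_prod_cong_AE mean_zero_L2D(1) x hH B_mean_zero_L2 k)
    \<comment> \<open>The identity term of \<open>B\<close> cancels against the right-hand
      side.\<close>
    then have "(\<Sum>r=1..k-1. shift_coeff k D d ((P k ^^ r) h) i + shift_coeff k D d ((P_adj k ^^ r) h) i) = 0"
      using i' by (simp add: inner_prod_B[OF k x hH] shift_coeff_def)
    then have "(\<Sum>r=1..k-1. b (i - r) + b (i + r)) = 0"
      using i' D k hH by (simp add: shift_coeff_P_power shift_coeff_P_adj_power b_def)
    moreover have "b j = 0" if "j = 0 \<or> j > n" for j
      using that by (auto simp: b_def shift_coeff_def n_def)
    ultimately show ?thesis
      using sum_translates[of n b k i] i by (simp add: n_def)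
  qed
  \<comment> \<open>Summing \<open>b_eq\<close> over \<open>i\<close> gives \<open>s = n * s\<close>
    for the total \<open>s\<close>, so \<open>n \<ge> 2\<close> forces \<open>s = 0\<close>.\<close>
  have "(\<Sum>j=1..n. b j) = (\<Sum>i=1..n. \<Sum>j=1..n. b j)"
    by (intro sum.cong b_eq[symmetric] refl)
  then have "(\<Sum>j=1..n. b j) = 0"
    using n2 by simp
  moreover have "m \<in> {1..n}" using md by (auto simp: n_def)
  ultimately have "b m = 0" using b_eq by metis
  then show ?thesis using md by (simp add: b_def shift_coeff_def ID)
qed

text \<open>Test the adjoint identity against \<open>P_adj k f\<close> itself: its squared norm
  becomes an inner product of \<open>f\<close> with an element of the range of
  \<open>P\<close>.\<close>

lemma P_adj_eq_0:
  assumes k: "k \<ge> 1" and f: "f \<in> \<H> k" and orth: "\<And>g. g \<in> \<H> k \<Longrightarrow> inner_prod k (P k g) f = 0"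
  shows "AE x in \<pi> k. P_adj k f x = 0"
proof (rule inner_prod_self_eq_0)
  show "P_adj k f \<in> \<H> k" by (rule P_adj_mean_zero_L2[OF k f])
  then show "inner_prod k (P_adj k f) (P_adj k f) = 0"
    using inner_prod_P_adj[OF k f] orth by metis
qed

text \<open>\<open>P_adj k f\<close> is known to vanish only almost everywhere, so the induction
  passes on orthogonality to the range of \<open>P\<close>, which every null function has.\<close>

lemma P_adj_power_eq_0:
  assumes k: "k \<ge> 1" and f: "f \<in> \<H> k" and orth: "\<And>g. g \<in> \<H> k \<Longrightarrow> inner_prod k (P k g) f = 0"
    and "r \<ge> 1"
  shows "AE x in \<pi> k. (P_adj k ^^ r) f x = 0"
  using \<open>r \<ge> 1\<close>
proof (induction r rule: dec_induct)
  case base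
  then show ?case using P_adj_eq_0[OF k f orth] by simp
next
  case (step r)
  have H: "(P_adj k ^^ r) f \<in> \<H> k" by (rule P_adj_power_mean_zero_L2[OF k f])
  have "inner_prod k (P k g) ((P_adj k ^^ r) f) = 0" if "g \<in> \<H> k" for g
  proof -
    have "inner_prod k (P k g) ((P_adj k ^^ r) f) = inner_prod k (P k g) (\<lambda>_. 0)"
      using that step.IH
      by (intro inner_prod_cong_AE mean_zero_L2D(1)[OF H] mean_zero_L2D(1)[OF P_mean_zero_L2[OF k that]]) auto
    then show ?thesis by (simp add: inner_prod_def)
  qed
  from P_adj_eq_0[OF k H this] show ?case by simp
qed

text \<open>The two equations say that the integrals over the last and the first coordinate vanish,
  the other description of \<open>\<L>\<^sub>1\<close>. Positive powers of \<open>P\<close> and,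
  almost everywhere, of its adjoint then annihilate \<open>f\<close>, so only the identity term of
  \<open>B k f\<close> is left.\<close>

lemma eigenspace_oneI:
  assumes k: "k \<ge> 1" and f: "f \<in> \<H> k" and P0: "P k f = (\<lambda>_. 0)" and Q0: "Q k f = (\<lambda>_. 0)"
  shows "f \<in> \<L>\<^sub>1 k"
proof -
  have P_pow: "(P k ^^ r) f = (\<lambda>_. 0)" if "r \<ge> 1" for r
    using that by (induction r rule: dec_induct) (simp_all add: P0, simp add: P_def)
  have "inner_prod k (P k g) f = 0" if "g \<in> \<H> k" for g
    unfolding inner_prod_P[OF k f that] Q0 by (simp add: inner_prod_def)
  then have "AE x in \<pi> k. \<forall>r\<in>{1..k-1}. (P_adj k ^^ r) f x = 0"
    by (intro AE_finite_allI P_adj_power_eq_0[OF k f]) auto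
  then have "AE x in \<pi> k. B k f x = f x"
    by eventually_elim (simp add: B_def P_pow)
  with f show ?thesis by (simp add: eigenspace_one_def)
qed

section \<open>The incremental component of the elementary symmetric polynomial\<close>

definition end_sets :: "nat \<Rightarrow> nat \<Rightarrow> nat set set"
  where "end_sets l k = {I. I \<subseteq> {1..k} \<and> card I = l \<and> 1 \<in> I \<and> k \<in> I}"

definition elem_sym_inc :: "nat \<Rightarrow> nat \<Rightarrow> (nat \<Rightarrow> real) \<Rightarrow> real"
  where "elem_sym_inc l k x = (\<Sum>I\<in>end_sets l k. xprod I x)"

lemma end_sets_subset: "end_sets l k \<subseteq> {I. I \<subseteq> {1..k} \<and> card I = l}"
  by (auto simp: end_sets_def)

lemma finite_end_sets: "finite (end_sets l k)"
  by (rule finite_subset[of _ "Pow {1..k}"]) (auto simp: end_sets_def)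

text \<open>Removing the two ends, distinct because \<open>k \<ge> 2\<close>, leaves an arbitrary
  subset of size \<open>l - 2\<close> of the \<open>k - 2\<close> interior points.\<close>

lemma card_end_sets:
  assumes "l \<ge> 2" "k \<ge> l"
  shows "card (end_sets l k) = (k - 2) choose (l - 2)"
proof -
  have "bij_betw (\<lambda>I. I - {1, k}) (end_sets l k) {J. J \<subseteq> {2..k-1} \<and> card J = l - 2}"
  proof (rule bij_betw_byWitness[where f' = "\<lambda>J. J \<union> {1, k}"])
    show "(\<lambda>I. I - {1, k}) ` end_sets l k \<subseteq> {J. J \<subseteq> {2..k-1} \<and> card J = l - 2}"
    proof (rule image_subsetI)
      fix I assume "I \<in> end_sets l k"
      then have I: "I \<subseteq> {1..k}" "card I = l" "{1, k} \<subseteq> I" by (auto simp: end_sets_def)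
      then have "card (I - {1, k}) = card I - card {1, k}"
        by (intro card_Diff_subset) (auto intro: finite_subset)
      then have "card (I - {1, k}) = l - 2"
        using assms I(2) by simp
      moreover have "I - {1, k} \<subseteq> {2..k-1}"
        using I(1) by force
      ultimately show "I - {1, k} \<in> {J. J \<subseteq> {2..k-1} \<and> card J = l - 2}" by simp
    qed
    show "(\<lambda>J. J \<union> {1, k}) ` {J. J \<subseteq> {2..k-1} \<and> card J = l - 2} \<subseteq> end_sets l k"
    proof safe
      fix J :: "nat set" assume J: "J \<subseteq> {2..k-1}" "card J = l - 2"
      then have "card (J \<union> {1, k}) = card J + card {1, k}"
        using assms by (intro card_Un_disjoint) (auto intro: finite_subset)
      then show "J \<union> {1, k} \<in> end_sets l k"
        using J assms by (force simp: end_sets_def)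
    qed
  qed (use assms in \<open>auto simp: end_sets_def\<close>)
  then have "card (end_sets l k) = card {J. J \<subseteq> {2..k-1} \<and> card J = l - 2}"
    by (rule bij_betw_same_card)
  also have "\<dots> = (k - 2) choose (l - 2)"
    by (subst n_subsets) (auto simp: numeral_2_eq_2)
  finally show ?thesis .
qed

lemma finite_index_sets: "finite {I. I \<subseteq> {1..k::nat} \<and> card I = l}"
  by (rule finite_subset[of _ "Pow {1..k}"]) auto

lemma elem_sym_mean_zero_L2: "l \<ge> 1 \<Longrightarrow> elem_sym l k \<in> \<H> k"
  unfolding elem_sym_eq[abs_def]
  by (intro mean_zero_L2_sum finite_index_sets) (auto intro!: xprod_mean_zero_L2)

lemma elem_sym_inc_mean_zero_L2: "l \<ge> 1 \<Longrightarrow> elem_sym_inc l k \<in> \<H> k"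
  unfolding elem_sym_inc_def[abs_def]
  by (intro mean_zero_L2_sum finite_end_sets) (auto simp: end_sets_def intro!: xprod_mean_zero_L2)

text \<open>Every monomial of the sum contains \<open>x 1\<close> and \<open>x k\<close>, so in
  either window it is linear in the fresh variable; the witness \<open>c\<close> collects the
  remaining factors.\<close>

lemma elem_sym_inc_eigenspace_one:
  assumes "l \<ge> 1" "k \<ge> 1"
  shows "elem_sym_inc l k \<in> \<L>\<^sub>1 k"
proof (rule eigenspace_oneI[OF assms(2) elem_sym_inc_mean_zero_L2[OF assms(1)]])
  show "P k (elem_sym_inc l k) = (\<lambda>_. 0)"
  proof
    fix x show "P k (elem_sym_inc l k) x = 0"
      by (rule P_eq_0[where c = "\<Sum>I\<in>end_sets l k. xprod (Suc ` (I - {k})) x"])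
        (auto simp: elem_sym_inc_def sum_distrib_left end_sets_def xprod_window_right intro!: sum.cong)
  qed
  show "Q k (elem_sym_inc l k) = (\<lambda>_. 0)"
  proof
    fix x show "Q k (elem_sym_inc l k) x = 0"
      by (rule Q_eq_0[where c = "\<Sum>I\<in>end_sets l k. xprod ((\<lambda>i. i - 1) ` (I - {1})) x"])
        (auto simp: elem_sym_inc_def sum_distrib_left end_sets_def xprod_window_left intro!: sum.cong)
  qed
qed

text \<open>The difference consists of monomials missing \<open>x 1\<close> or \<open>x k\<close>,
  each of them orthogonal to \<open>\<L>\<^sub>1\<close>.\<close>

lemma elem_sym_inc_orthogonal:
  assumes l: "l \<ge> 1" and h: "h \<in> \<L>\<^sub>1 k"
  shows "inner_prod k (\<lambda>x. elem_sym l k x - elem_sym_inc l k x) h = 0"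
proof -
  let ?S = "{I. I \<subseteq> {1..k} \<and> card I = l}"
  have hH: "h \<in> \<H> k" using h by (simp add: eigenspace_one_def)
  have "elem_sym l k x - elem_sym_inc l k x = (\<Sum>I\<in>?S - end_sets l k. xprod I x)" for x
    using end_sets_subset finite_index_sets by (simp add: elem_sym_eq elem_sym_inc_def sum_diff)
  then have "inner_prod k (\<lambda>x. elem_sym l k x - elem_sym_inc l k x) h =
      (\<Sum>I\<in>?S - end_sets l k. inner_prod k (xprod I) h)"
    using l by (simp only:) (rule inner_prod_sum_left[OF hH], auto intro!: xprod_mean_zero_L2)
  also have "\<dots> = 0"
    using l by (intro sum.neutral ballI inner_prod_xprod_eigenspace_one[OF h]) (auto simp: end_sets_def)
  finally show ?thesis .
qed

text \<open>The norm of an orthogonal projection does not depend on the representative that \<open>SOME\<close> picks.\<close>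
lemma inner_prod_f_inc:
  assumes f: "f \<in> \<H> k" and p: "p \<in> \<L>\<^sub>1 k"
    and orth: "\<And>h. h \<in> \<L>\<^sub>1 k \<Longrightarrow> inner_prod k (\<lambda>x. f x - p x) h = 0"
  shows "inner_prod k (f_inc k f) (f_inc k f) = inner_prod k p p"
proof -
  let ?q = "f_inc k f"
  have "?q \<in> \<L>\<^sub>1 k \<and> (\<forall>h\<in>\<L>\<^sub>1 k. inner_prod k (\<lambda>x. f x - ?q x) h = 0)"
    unfolding f_inc_def by (rule someI[of _ p]) (use p orth in auto)
  then have q: "?q \<in> \<L>\<^sub>1 k" and q_orth: "\<And>h. h \<in> \<L>\<^sub>1 k \<Longrightarrow> inner_prod k (\<lambda>x. f x - ?q x) h = 0"
    by auto
  have H: "h \<in> \<H> k" if "h \<in> \<L>\<^sub>1 k" for h using that by (simp add: eigenspace_one_def)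
  have eq: "inner_prod k f h = inner_prod k ?q h" "inner_prod k f h = inner_prod k p h"
    if "h \<in> \<L>\<^sub>1 k" for h
    using q_orth[OF that] orth[OF that] by (simp_all add: inner_prod_diff_left f H that p q)
  \<comment> \<open>With \<open>q\<close> and \<open>p\<close> as test functions:
    \<open><q,q> = <f,q> = <p,q> = <q,p> = <f,p> = <p,p>\<close>.\<close>
  show ?thesis
    using eq(1,2)[OF q] eq(1,2)[OF p] by (simp add: inner_prod_commute)
qed

lemma L2_nrm_f_inc_elem_sym:
  assumes "l \<ge> 1" "k \<ge> l"
  shows "(L2_nrm k (f_inc k (elem_sym l k)))\<^sup>2 = card (end_sets l k)"
proof -
  have "inner_prod k (f_inc k (elem_sym l k)) (f_inc k (elem_sym l k)) =
      inner_prod k (elem_sym_inc l k) (elem_sym_inc l k)"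
    using assms
    by (intro inner_prod_f_inc elem_sym_mean_zero_L2 elem_sym_inc_eigenspace_one elem_sym_inc_orthogonal) auto
  also have "\<dots> = card (end_sets l k \<inter> end_sets l k)"
    unfolding elem_sym_inc_def[abs_def] using assms
    by (intro inner_prod_sum_xprod finite_end_sets) (auto simp: end_sets_def)
  finally show ?thesis by (simp add: L2_nrm_def)
qed

section \<open>The asymptotic variance\<close>

text \<open>Independence makes the joint law a product measure, so that integrals over
  \<open>M\<close> can be computed in \<open>\<pi> n\<close>.\<close>

lemma distr_iid_std_normal:
  assumes X: "iid_std_normal M X" and n: "n \<ge> 1"
  shows "Y X n 1 \<in> measurable M (\<pi> n)" "distr M (\<pi> n) (Y X n 1) = \<pi> n"
proof -
  interpret prob_space M using X by (simp add: iid_std_normal_def)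
  have indep: "indep_vars (\<lambda>_. borel) X {1..n}"
    using X by (auto simp: iid_std_normal_def intro: indep_vars_subset)
  have rv: "X i \<in> borel_measurable M" if "i \<in> {1..n}" for i
    using indep that by (auto simp: indep_vars_def)
  have Y1: "Y X n 1 = (\<lambda>\<omega>. \<lambda>j\<in>{1..n}. X j \<omega>)"
    by (rule ext) (simp add: Y_def)
  show "Y X n 1 \<in> measurable M (\<pi> n)"
    unfolding Y1 by (rule measurable_into_gauss) (auto simp: rv)
  have "distr M (PiM {1..n} (\<lambda>_. borel)) (\<lambda>x. \<lambda>i\<in>{1..n}. X i x) = PiM {1..n} (\<lambda>i. distr M borel (X i))"
    using indep n rv by (subst indep_vars_iff_distr_eq_PiM'[symmetric]) auto
  also have "\<dots> = \<pi> n"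
    unfolding gauss_def using X by (intro PiM_cong) (auto simp: iid_std_normal_def)
  also have "distr M (PiM {1..n} (\<lambda>_. borel)) (\<lambda>x. \<lambda>i\<in>{1..n}. X i x) = distr M (\<pi> n) (Y X n 1)"
    unfolding gauss_def Y1 by (intro distr_cong sets_PiM_cong) auto
  finally show "distr M (\<pi> n) (Y X n 1) = \<pi> n" .
qed

text \<open>Both windows of a covariance are to be read inside one longer window, in which the later
  one has its indices raised by \<open>r\<close>.\<close>

lemma elem_sym_Y:
  "elem_sym l k (Y X k (1 + r) \<omega>) =
    (\<Sum>J\<in>(`) ((+) r) ` {I. I \<subseteq> {1..k} \<and> card I = l}. xprod J (Y X (k + r) 1 \<omega>))"
proof -
  have "inj_on ((`) ((+) r)) A" for A :: "nat set set"
    by (rule inj_onI) (simp add: inj_image_eq_iff)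
  moreover have "xprod I (Y X k (1 + r) \<omega>) = xprod ((+) r ` I) (Y X (k + r) 1 \<omega>)" if "I \<subseteq> {1..k}" for I
    unfolding xprod_def using that
    by (subst prod.reindex) (auto simp: Y_def intro!: prod.cong)
  ultimately show ?thesis
    by (simp add: elem_sym_eq sum.reindex)
qed

text \<open>Inside the common window of length \<open>k + r\<close>, the covariance counts the index
  sets that the two polynomials share: the subsets of size \<open>l\<close> of the overlap
  \<open>{r+1..k}\<close>.\<close>

lemma Cov_elem_sym:
  assumes X: "iid_std_normal M X" and l: "l \<ge> 1" and k: "k \<ge> 1"
  shows "Cov M (\<lambda>\<omega>. elem_sym l k (Y X k 1 \<omega>)) (\<lambda>\<omega>. elem_sym l k (Y X k (1 + r) \<omega>)) = (k - r) choose l"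
proof -
  define n where "n = k + r"
  define S where "S = {I. I \<subseteq> {1..k} \<and> card I = l}"
  define S' where "S' = (`) ((+) r) ` S"
  define f where "f x = (\<Sum>I\<in>S. xprod I x)" for x
  define g where "g x = (\<Sum>I\<in>S'. xprod I x)" for x
  have n: "n \<ge> 1" using k by (simp add: n_def)
  note Yn = distr_iid_std_normal[OF X n]
  have fin: "finite S" "finite S'"
    using finite_index_sets[of k l] by (auto simp: S_def S'_def)
  have sub: "S \<union> S' \<subseteq> Pow {1..n} - {{}}"
    using l by (force simp: S_def S'_def n_def)
  have "xprod I \<in> \<H> n" if "I \<in> S \<union> S'" for I
    by (rule xprod_mean_zero_L2) (use that sub in blast)+
  then have H: "f \<in> \<H> n" "g \<in> \<H> n"
    unfolding f_def[abs_def] g_def[abs_def] using fin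
    by (auto intro: mean_zero_L2_sum)
  note [measurable] = Yn(1) mean_zero_L2D(1)[OF H(1)] mean_zero_L2D(1)[OF H(2)]
  have transfer: "(\<integral>\<omega>. u (Y X n 1 \<omega>) \<partial>M) = integral\<^sup>L (\<pi> n) u" if "u \<in> borel_measurable (\<pi> n)" for u :: "_ \<Rightarrow> real"
    using integral_distr[OF Yn(1) that] unfolding Yn(2) by (rule sym)
  have fY: "elem_sym l k (Y X k 1 \<omega>) = f (Y X n 1 \<omega>)" for \<omega>
    unfolding f_def S_def elem_sym_eq
    by (intro sum.cong refl) (auto simp: xprod_def Y_def n_def intro!: prod.cong)
  have gY: "elem_sym l k (Y X k (1 + r) \<omega>) = g (Y X n 1 \<omega>)" for \<omega>
    unfolding g_def S'_def S_def n_def by (rule elem_sym_Y)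
  have "S \<inter> S' = {J. J \<subseteq> {r+1..k} \<and> card J = l}"
  proof (intro equalityI subsetI)
    fix J assume "J \<in> {J. J \<subseteq> {r+1..k} \<and> card J = l}"
    then have J: "J \<subseteq> {r+1..k}" "card J = l" by auto
    define I where "I = (\<lambda>i. i - r) ` J"
    have JI: "J = (+) r ` I" using J(1) by (force simp: I_def image_image)
    have "I \<subseteq> {1..k}" using J(1) by (force simp: I_def)
    moreover have "card I = l"
      using J(2) JI by (metis card_image inj_on_add)
    ultimately show "J \<in> S \<inter> S'"
      using J JI by (auto simp: S_def S'_def)
  qed (force simp: S_def S'_def)
  then have "card (S \<inter> S') = (k - r) choose l"
    by (simp add: n_subsets)
  moreover have "inner_prod n f g = card (S \<inter> S')"
    unfolding f_def[abs_def] g_def[abs_def] by (rule inner_prod_sum_xprod[OF fin sub])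
  moreover have "Cov M (\<lambda>\<omega>. f (Y X n 1 \<omega>)) (\<lambda>\<omega>. g (Y X n 1 \<omega>)) = inner_prod n f g"
    unfolding Cov_def transfer[OF mean_zero_L2D(1)[OF H(1)]] transfer[OF mean_zero_L2D(1)[OF H(2)]]
      mean_zero_L2D(3)[OF H(1)] mean_zero_L2D(3)[OF H(2)] inner_prod_def
    using transfer[of "\<lambda>x. f x * g x"] by simp
  ultimately show ?thesis
    by (simp only: fY gY)
qed

lemma asymp_var_elem_sym:
  assumes X: "iid_std_normal M X" and l: "l \<ge> 1" and k: "k \<ge> 1"
  shows "asymp_var M X k (elem_sym l k) = (k choose l) + 2 * (k choose (l + 1))"
proof -
  note C = Cov_elem_sym[OF X l k]
  have "(\<Sum>r=1..k-1. (k - r) choose l) = (\<Sum>j=1..k-1. j choose l)"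
    by (rule sum.reindex_bij_witness[of _ "\<lambda>j. k - j" "\<lambda>r. k - r"]) auto
  \<comment> \<open>The added term \<open>j = 0\<close> vanishes since \<open>l \<ge> 1\<close>; the
    hockey-stick identity then applies.\<close>
  also have "\<dots> = (\<Sum>j\<le>k-1. j choose l)"
    using l by (intro sum.mono_neutral_left) (auto simp: not_le)
  also have "\<dots> = k choose (l + 1)"
    using k by (simp add: sum_choose_upper del: binomial_Suc_Suc)
  finally have "(\<Sum>r=1..k-1. real ((k - r) choose l)) = real (k choose (l + 1))"
    by (simp flip: of_nat_sum)
  \<comment> \<open>The variance is the covariance at distance 0.\<close>
  moreover have "(\<integral>\<omega>. (elem_sym l k (Y X k 1 \<omega>) - (\<integral>\<omega>. elem_sym l k (Y X k 1 \<omega>) \<partial>M))\<^sup>2 \<partial>M) = real (k choose l)"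
    using C[of 0] by (simp add: Cov_def power2_eq_square)
  ultimately show ?thesis
    unfolding asymp_var_def C by simp
qed

section \<open>The closed form of the index and its monotonicity\<close>

lemma binomial_minus_two:
  assumes "2 \<le> l" "l \<le> k"
  shows "real l * (real l - 1) * real (k choose l) = real k * (real k - 1) * real ((k - 2) choose (l - 2))"
proof -
  have "l * (k choose l) = k * ((k - 1) choose (l - 1))"
    "(l - 1) * ((k - 1) choose (l - 1)) = (k - 1) * ((k - 2) choose (l - 2))"
    using times_binomial_minus1_eq[of l k] times_binomial_minus1_eq[of "l - 1" "k - 1"] assms
    by (simp_all add: numeral_2_eq_2)
  then have "real l * real (k choose l) = real k * real ((k - 1) choose (l - 1))"
    "(real l - 1) * real ((k - 1) choose (l - 1)) = (real k - 1) * real ((k - 2) choose (l - 2))"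
    using assms by (metis of_nat_mult, metis (no_types) of_nat_mult of_nat_diff of_nat_1 le_trans one_le_numeral)
  then show ?thesis by algebra
qed

text \<open>Squared norm and asymptotic variance are both rational multiples of
  \<open>k choose l\<close>, which cancels.\<close>

lemma rel_inc_index_elem_sym:
  assumes X: "iid_std_normal M X" and l: "l \<ge> 2" and k: "k \<ge> l"
  shows "rel_inc_index M X k (elem_sym l k) =
    real l * (real l - 1) * (real l + 1) / (real k * (real k - 1) * (2 * real k - real l + 1))"
proof -
  define c where "c = real (k choose l)"
  have c: "c > 0" using k by (simp add: c_def)
  have pos: "real k * (real k - 1) > 0" "2 * real k - real l + 1 > 0" using l k by auto
  have norm: "(L2_nrm k (f_inc k (elem_sym l k)))\<^sup>2 = real l * (real l - 1) * c / (real k * (real k - 1))"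
    using L2_nrm_f_inc_elem_sym[of l k] card_end_sets[of l k] binomial_minus_two[of l k] l k pos
    by (simp add: c_def field_simps)
  \<comment> \<open>This turns the variance into
    \<open>c * (1 + 2 * (k - l) / (l + 1))\<close>.\<close>
  have "(l + 1) * (k choose (l + 1)) = (k - l) * (k choose l)"
    using binomial_absorb_comp[of k l] binomial_absorption[of l k] k by simp
  then have "(real l + 1) * real (k choose (l + 1)) = (real k - real l) * c"
    using k unfolding c_def by (metis of_nat_1 of_nat_add of_nat_diff of_nat_mult)
  then have var: "asymp_var M X k (elem_sym l k) = c * (2 * real k - real l + 1) / (real l + 1)"
    using asymp_var_elem_sym[OF X, of l k] l k by (simp add: c_def field_simps)
  have "a * c / b / (c * d / e) = a * e / (b * d)" for a b d e :: real
    using c by simp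
  then show ?thesis
    unfolding rel_inc_index_def norm var .
qed

theorem proposition4p6:
  fixes M :: "'w measure" and X :: "nat \<Rightarrow> 'w \<Rightarrow> real" and l :: nat
  assumes "iid_std_normal M X"
    and "l \<ge> 2"
  shows "(\<forall>k\<ge>l. rel_inc_index M X k (elem_sym l k) =
            real l * (real l - 1) * (real l + 1) /
            (real k * (real k - 1) * (2 * real k - real l + 1))) \<and>
         strict_antimono_on {l..} (\<lambda>k. rel_inc_index M X k (elem_sym l k))"
proof
  show "\<forall>k\<ge>l. rel_inc_index M X k (elem_sym l k) =
            real l * (real l - 1) * (real l + 1) /
            (real k * (real k - 1) * (2 * real k - real l + 1))"
    using rel_inc_index_elem_sym[OF assms] by blast
  show "strict_antimono_on {l..} (\<lambda>k. rel_inc_index M X k (elem_sym l k))"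
  proof (rule monotone_onI)
    fix k m :: nat
    assume km: "k \<in> {l..}" "m \<in> {l..}" "k < m"
    \<comment> \<open>The numerator is constant in \<open>k\<close>, while the denominator is a
      product of positive factors that strictly increase with \<open>k\<close>.\<close>
    have "real k * (real k - 1) * (2 * real k - real l + 1) <
        real m * (real m - 1) * (2 * real m - real l + 1)"
      using km assms(2) by (intro mult_strict_mono mult_pos_pos) auto
    moreover have "real k * (real k - 1) * (2 * real k - real l + 1) > 0"
      using km assms(2) by (intro mult_pos_pos) auto
    moreover have "real l * (real l - 1) * (real l + 1) > 0"
      using assms(2) by (intro mult_pos_pos) auto
    ultimately show "rel_inc_index M X m (elem_sym l m) < rel_inc_index M X k (elem_sym l k)"
      using km assms by (simp add: rel_inc_index_elem_sym divide_strict_left_mono)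
  qed
qed

end
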